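(* Let $0<q<1$, let $\alpha\in\mathbb{R}$, and for $x>0$ let $$h_\alpha(x)=\log\left[(1-q)^x(1-q^x)^\alpha\,\Gamma_q(x)\exp\left(\sum_{k=1}^\infty \frac{q^{kx}}{k^2\log q}\right)\right].$$ Then $-h_\alpha'(x)$ is completely monotonic on $(0,\infty)$ for $\alpha\le 1/2$, and $h_\alpha'(x)$ is completely monotonic on $(0,\infty)$ for $\alpha\ge 1$.
   Context: For $0<q<1$ the $q$-gamma function is $\Gamma_q(x)=(1-q)^{1-x}\prod_{n=0}^\infty \frac{1-q^{n+1}}{1-q^{n+x}}$. A function $f$ is completely monotonic on an interval $I$ if it has derivatives of all orders on $I$ and $(-1)^n f^{(n)}(x)\ge 0$ for all $x\in I$ and all $n=0,1,2,\dots$. *)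

theory Defs
  imports "HOL-Analysis.Analysis"
begin

(* The q-gamma function for 0 < q < 1.  At its poles x = 0, -1, -2, ... one factor
   is a division by zero, so the value there is meaningless. *)
definition q_Gamma :: "real \<Rightarrow> real \<Rightarrow> real" where
  "q_Gamma q x =
     (1 - q) powr (1 - x) * (\<Prod>n. (1 - q ^ (n + 1)) / (1 - q powr (real n + x)))"

(* Two-sided derivatives are used, so I is meant to be an open interval. *)
definition completely_monotonic_on :: "real set \<Rightarrow> (real \<Rightarrow> real) \<Rightarrow> bool" where
  "completely_monotonic_on I f \<longleftrightarrow>
     (\<forall>n. \<forall>x\<in>I. (deriv ^^ n) f field_differentiable at x \<and>
                 (-1) ^ n * (deriv ^^ n) f x \<ge> 0)"

(* The series over k = 1, 2, ... is indexed from 0, with Suc k in place of k. *)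
definition h :: "real \<Rightarrow> real \<Rightarrow> real \<Rightarrow> real" where
  "h q \<alpha> x =
     ln ((1 - q) powr x * (1 - q powr x) powr \<alpha> * q_Gamma q x *
         exp (\<Sum>k. q powr (real (Suc k) * x) / (real (Suc k) ^ 2 * ln q)))"

end

theory Submission
  imports Defs
begin

text \<open>Put \<open>y = q powr x\<close>. Expanding the logarithms, \<open>h q \<alpha>\<close> is a constant plus the power series
  in \<open>y\<close> with coefficients \<open>(1 / (1 - exp (- t)) - 1 / t - \<alpha>) / k\<close>, where \<open>t = - k * ln q\<close>.
  Since \<open>1 / (1 - exp (- t)) - 1 / t\<close> lies between \<open>1 / 2\<close> and \<open>1\<close>, all coefficients have one
  sign in either case, and each derivative in \<open>x\<close> multiplies the coefficients by \<open>k * ln q < 0\<close>.\<close>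

section \<open>Power series in \<open>q powr x\<close> and their derivatives\<close>

lemma powr_less_one_of_base:
  fixes q x :: real
  assumes "0 < q" "q < 1" "0 < x"
  shows "q powr x < 1"
  using assms by (simp add: powr_def mult_pos_neg)

text \<open>The operator y d/dy multiplies the k-th coefficient by k. The factor y undoes the index
  shift of the termwise derivative \<open>diffs a\<close>, and the term at k = 0 vanishes.\<close>

lemma summable_mult_index_power:
  fixes a :: "nat \<Rightarrow> real"
  assumes "\<And>y. \<bar>y\<bar> < 1 \<Longrightarrow> summable (\<lambda>k. a k * y ^ k)" and "\<bar>y\<bar> < 1"
  shows "(\<lambda>k. real k * a k * y ^ k) sums (y * (\<Sum>k. diffs a k * y ^ k))"
proof -
  have "summable (\<lambda>k. diffs a k * y ^ k)"
    by (rule termdiff_converges[where K = 1]) (use assms in auto)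
  then have "(\<lambda>k. y * (diffs a k * y ^ k)) sums (y * (\<Sum>k. diffs a k * y ^ k))"
    by (intro sums_mult summable_sums)
  then have "(\<lambda>k. real (Suc k) * a (Suc k) * y ^ Suc k) sums (y * (\<Sum>k. diffs a k * y ^ k))"
    by (simp add: diffs_def mult_ac)
  then show ?thesis
    by (subst (asm) sums_Suc_iff) simp
qed

text \<open>By the chain rule with y = \<open>q powr x\<close> and dy/dx = y * \<open>ln q\<close>,
  differentiation in x acts as \<open>ln q\<close> times y d/dy.\<close>

lemma has_field_derivative_powr_series:
  fixes a :: "nat \<Rightarrow> real" and q x :: real
  assumes q: "0 < q" "q < 1" and x: "0 < x"
    and a: "\<And>y. \<bar>y\<bar> < 1 \<Longrightarrow> summable (\<lambda>k. a k * y ^ k)"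
  shows "((\<lambda>x. \<Sum>k. a k * (q powr x) ^ k) has_field_derivative
           (\<Sum>k. real k * ln q * a k * (q powr x) ^ k)) (at x)"
proof -
  define y where "y = q powr x"
  have y: "\<bar>y\<bar> < 1"
    using q x by (simp add: y_def powr_less_one_of_base)
  have D: "((\<lambda>z. \<Sum>k. a k * z ^ k) has_field_derivative (\<Sum>k. diffs a k * y ^ k)) (at y)"
    by (rule termdiffs_strong'[where K = 1]) (use a y in auto)
  have P: "((\<lambda>x. q powr x) has_field_derivative y * ln q) (at x)"
    using q unfolding y_def by (auto intro!: derivative_eq_intros)
  have "(\<lambda>k. ln q * (real k * a k * y ^ k)) sums (ln q * (y * (\<Sum>k. diffs a k * y ^ k)))"
    by (intro sums_mult summable_mult_index_power a y)
  then have "(\<Sum>k. real k * ln q * a k * y ^ k) = (\<Sum>k. diffs a k * y ^ k) * (y * ln q)"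
    by (simp add: sums_iff mult_ac)
  with DERIV_chain2[OF D[unfolded y_def] P] show ?thesis
    by (simp add: y_def)
qed

text \<open>The three claims go through one induction: to differentiate once more, both the series
  formula for the n-th derivative and the convergence of that series are needed.\<close>

lemma higher_deriv_powr_series:
  fixes a :: "nat \<Rightarrow> real" and q :: real
  assumes q: "0 < q" "q < 1"
    and a: "\<And>y. \<bar>y\<bar> < 1 \<Longrightarrow> summable (\<lambda>k. a k * y ^ k)"
    and f: "\<And>x. 0 < x \<Longrightarrow> f x = (\<Sum>k. a k * (q powr x) ^ k)"
  shows "(\<forall>x>0. (deriv ^^ n) f x = (\<Sum>k. (real k * ln q) ^ n * a k * (q powr x) ^ k)) \<and>
         (\<forall>y. \<bar>y\<bar> < 1 \<longrightarrow> summable (\<lambda>k. (real k * ln q) ^ n * a k * y ^ k)) \<and>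
         (\<forall>x>0. (deriv ^^ n) f field_differentiable at x)"
proof (induction n)
  \<comment> \<open>Agreement of \<open>g\<close> with its series is known only on the open
    half-line, which suffices for the two-sided derivative at a point x > 0. The fact is stated for
    arbitrary \<open>b\<close> and \<open>g\<close> so that it serves both \<open>f\<close> and its
    iterated derivatives.\<close>
  have step: "(g has_field_derivative (\<Sum>k. real k * ln q * b k * (q powr x) ^ k)) (at x)"
    if b: "\<And>y. \<bar>y\<bar> < 1 \<Longrightarrow> summable (\<lambda>k. b k * y ^ k)"
      and g: "\<And>x. 0 < x \<Longrightarrow> g x = (\<Sum>k. b k * (q powr x) ^ k)" and "0 < x" for b g x
    by (rule has_field_derivative_transform_within_open
          [OF has_field_derivative_powr_series[OF q \<open>0 < x\<close> b], of "{0<..}"])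
      (use g \<open>0 < x\<close> in auto)
  {
    case 0
    have "f field_differentiable at x" if "0 < x" for x
      using step[OF a f that] by (auto simp: field_differentiable_def)
    then show ?case
      using a f by simp
  next
    case (Suc n)
    let ?b = "\<lambda>n k. (real k * ln q) ^ n * a k"
    have D: "((deriv ^^ n) f has_field_derivative (\<Sum>k. ?b (Suc n) k * (q powr x) ^ k)) (at x)"
      if "0 < x" for x
      using step[of "?b n" "(deriv ^^ n) f" x] Suc that by (simp add: mult_ac)
    have S: "summable (\<lambda>k. ?b (Suc n) k * y ^ k)" if "\<bar>y\<bar> < 1" for y
    proof -
      have "summable (\<lambda>k. ln q * (real k * ?b n k * y ^ k))"
        using summable_mult_index_power[of "?b n" y] Suc that
        by (intro summable_mult) (auto simp: sums_iff)
      then show ?thesis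
        by (simp add: mult_ac)
    qed
    have E: "(deriv ^^ Suc n) f x = (\<Sum>k. ?b (Suc n) k * (q powr x) ^ k)" if "0 < x" for x
      using DERIV_imp_deriv[OF D[OF that]] by simp
    have "(deriv ^^ Suc n) f field_differentiable at x" if "0 < x" for x
      using step[OF S E that] by (auto simp: field_differentiable_def)
    then show ?case
      using E S by blast
  }
qed

text \<open>The sign (-1)^n is absorbed into (k * ln q)^n, leaving (k * (- ln q))^n, which is
  nonnegative because q < 1. The series is then a sum of nonnegative terms.\<close>

lemma completely_monotonic_on_powr_series:
  fixes a :: "nat \<Rightarrow> real" and q :: real
  assumes q: "0 < q" "q < 1"
    and a: "\<And>y. \<bar>y\<bar> < 1 \<Longrightarrow> summable (\<lambda>k. a k * y ^ k)" and nonneg: "\<And>k. 0 \<le> a k"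
    and f: "\<And>x. 0 < x \<Longrightarrow> f x = (\<Sum>k. a k * (q powr x) ^ k)"
  shows "completely_monotonic_on {0<..} f"
  unfolding completely_monotonic_on_def
proof (intro allI ballI conjI)
  fix n :: nat and x :: real
  assume "x \<in> {0<..}"
  then have x: "0 < x" by simp
  note * = higher_deriv_powr_series[OF q a f, of n]
  show "(deriv ^^ n) f field_differentiable at x"
    using * x by blast
  have y: "\<bar>q powr x\<bar> < 1"
    using q x by (simp add: powr_less_one_of_base)
  have "(-1) ^ n * (deriv ^^ n) f x = (\<Sum>k. (-1) ^ n * ((real k * ln q) ^ n * a k * (q powr x) ^ k))"
    using * x y by (simp add: suminf_mult)
  also have "\<dots> = (\<Sum>k. (real k * - ln q) ^ n * a k * (q powr x) ^ k)"
    by (simp add: power_mult_distrib[symmetric] mult.assoc[symmetric])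
  also have "\<dots> \<ge> 0"
  proof (rule suminf_nonneg)
    have "summable (\<lambda>k. (-1) ^ n * ((real k * ln q) ^ n * a k * (q powr x) ^ k))"
      using * y by (intro summable_mult) blast
    then show "summable (\<lambda>k. (real k * - ln q) ^ n * a k * (q powr x) ^ k)"
      by (simp add: power_mult_distrib[symmetric] mult.assoc[symmetric])
    show "0 \<le> (real k * - ln q) ^ n * a k * (q powr x) ^ k" for k
      using q nonneg[of k] by (intro mult_nonneg_nonneg zero_le_power) (auto simp: ln_le_zero_iff)
  qed
  finally show "0 \<le> (-1) ^ n * (deriv ^^ n) f x" .
qed

section \<open>An elementary inequality and two series facts\<close>

lemma inverse_one_minus_exp_bounds:
  fixes t :: real
  assumes "0 < t"
  shows "1 / 2 \<le> 1 / (1 - exp (- t)) - 1 / t" and "1 / (1 - exp (- t)) - 1 / t \<le> 1"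
proof -
  have e: "0 < 1 - exp (- t)" using assms by simp
  \<comment> \<open>Clearing denominators turns the lower bound into \<open>?f t\<close> >= 0. Here
    \<open>?f 0\<close> = 0, and the derivative of \<open>?f\<close> is nonnegative because 1 + s <=
    exp s.\<close>
  let ?f = "\<lambda>s :: real. s - 2 + (s + 2) * exp (- s)"
  have "?f 0 \<le> ?f t"
  proof (rule DERIV_nonneg_imp_nondecreasing[where f = ?f])
    fix s :: real
    assume "0 \<le> s" "s \<le> t"
    have "(1 + s) * exp (- s) \<le> exp s * exp (- s)"
      by (intro mult_right_mono) auto
    then have "0 \<le> 1 - (1 + s) * exp (- s)"
      by (simp add: exp_minus)
    moreover have "(?f has_real_derivative 1 - (1 + s) * exp (- s)) (at s)"
      by (auto intro!: derivative_eq_intros simp: algebra_simps)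
    ultimately show "\<exists>y. (?f has_real_derivative y) (at s) \<and> 0 \<le> y" by blast
  qed (use assms in simp)
  then show "1 / 2 \<le> 1 / (1 - exp (- t)) - 1 / t"
    using e assms by (simp add: field_simps)
  \<comment> \<open>Cleared of denominators, the upper bound reads (1 + t) * exp (- t) <= 1.\<close>
  have "(1 + t) * exp (- t) \<le> exp t * exp (- t)"
    by (intro mult_right_mono) auto
  then have "(1 + t) * exp (- t) \<le> 1"
    by (simp add: exp_minus)
  then show "1 / (1 - exp (- t)) - 1 / t \<le> 1"
    using e assms by (simp add: field_simps)
qed

lemma summable_bounded_mult_power:
  fixes a :: "nat \<Rightarrow> real"
  assumes "\<And>k. \<bar>a k\<bar> \<le> B" and "\<bar>y\<bar> < 1"
  shows "summable (\<lambda>k. a k * y ^ k)"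
proof (rule summable_comparison_test')
  show "summable (\<lambda>k. B * \<bar>y\<bar> ^ k)"
    using assms(2) by (intro summable_mult summable_geometric) simp
  show "norm (a k * y ^ k) \<le> B * \<bar>y\<bar> ^ k" if "0 \<le> k" for k
    using assms(1)[of k] by (simp add: abs_mult power_abs mult_right_mono)
qed

text \<open>The Mercator series at -y. Its term at k = 0 is zero because \<open>1 / 0 = 0\<close>,
  so the index may start at 0.\<close>

lemma sums_ln_one_minus:
  fixes y :: real
  assumes "\<bar>y\<bar> < 1"
  shows "(\<lambda>k. 1 / real k * y ^ k) sums (- ln (1 - y))"
  using sums_minus[OF ln_series'[of "- y"]] assms by simp

section \<open>The logarithm of the infinite product and the q-gamma function\<close>

context
  fixes q :: real
  assumes q: "0 < q" "q < 1"
begin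

text \<open>For 0 <= y < 1 this is minus the logarithm of the q-Pochhammer symbol, the product of 1
  - q^n * y over n >= 0: expand each logarithm and sum the geometric series over n. The term at k =
  0 is 0 by division by zero.\<close>

definition q_log_series :: "real \<Rightarrow> real" where
  "q_log_series y = (\<Sum>k. 1 / (real k * (1 - q ^ k)) * y ^ k)"

lemma abs_q_log_series_coeff_le: "\<bar>1 / (real k * (1 - q ^ k))\<bar> \<le> 1 / (1 - q)"
proof (cases "k = 0")
  case False
  have "q ^ k \<le> q ^ 1"
    using q False by (intro power_decreasing) auto
  then have "1 * (1 - q) \<le> real k * (1 - q ^ k)"
    using q False by (intro mult_mono) auto
  moreover have "0 < 1 - q" using q by simp
  ultimately show ?thesis
    by (simp add: frac_le)
qed (use q in simp)

lemma summable_q_log_series: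
  "\<bar>y\<bar> < 1 \<Longrightarrow> summable (\<lambda>k. 1 / (real k * (1 - q ^ k)) * y ^ k)"
  by (rule summable_bounded_mult_power[OF abs_q_log_series_coeff_le])

text \<open>Coefficientwise this is q^k / (1 - q^k) + 1 = 1 / (1 - q^k), divided by k. It splits one
  factor 1 - y off the infinite product and so avoids interchanging a double sum.\<close>

lemma q_log_series_step:
  assumes "\<bar>y\<bar> < 1"
  shows "q_log_series y = q_log_series (q * y) - ln (1 - y)"
proof -
  have "\<bar>q * y\<bar> < 1"
    using q assms mult_strict_mono'[of "\<bar>q\<bar>" 1 "\<bar>y\<bar>" 1] by (simp add: abs_mult)
  note S = summable_sums[OF summable_q_log_series[OF this]]
  have "1 / (real k * (1 - q ^ k)) * (q * y) ^ k + 1 / real k * y ^ k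
          = 1 / (real k * (1 - q ^ k)) * y ^ k" for k
  proof (cases "k = 0")
    case False
    then have "q ^ k < 1" using q by (simp add: power_Suc_less_one power_less_one_iff)
    with False show ?thesis
      by (simp add: power_mult_distrib divide_simps) (simp add: algebra_simps)
  qed simp
  with sums_add[OF S sums_ln_one_minus[OF assms]] show ?thesis
    by (simp add: q_log_series_def sums_iff)
qed

text \<open>The functional equation, applied at y, q * y, q^2 * y and so on, telescopes.\<close>

lemma prod_one_minus_conv_q_log_series:
  assumes "0 \<le> y" "y < 1"
  shows "(\<Prod>n<N. 1 - q ^ n * y) = exp (q_log_series (q ^ N * y) - q_log_series y)"
proof (induction N)
  case (Suc N)
  have "q ^ N * y \<le> 1 * y"
    using q assms by (intro mult_right_mono power_le_one) auto
  then have b: "\<bar>q ^ N * y\<bar> < 1"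
    using q assms by simp
  then have "exp (ln (1 - q ^ N * y)) = 1 - q ^ N * y" by simp
  then show ?case
    using Suc q_log_series_step[OF b] by (simp add: exp_diff mult.assoc)
qed simp

lemma prod_one_minus_tendsto:
  assumes "0 \<le> y" "y < 1"
  shows "(\<lambda>N. \<Prod>n<N. 1 - q ^ n * y) \<longlonglongrightarrow> exp (- q_log_series y)"
proof -
  have "isCont q_log_series 0"
    unfolding q_log_series_def
    \<comment> \<open>Convergence at 1/2, a nonzero point of the unit disc, gives continuity at
      0.\<close>
    by (rule isCont_powser'[OF _ summable_q_log_series[of "1/2"]]) auto
  moreover have "(\<lambda>N. q ^ N * y) \<longlonglongrightarrow> 0 * y"
    using q by (intro tendsto_intros LIMSEQ_power_zero) auto
  ultimately have "(\<lambda>N. q_log_series (q ^ N * y)) \<longlonglongrightarrow> q_log_series 0"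
    using isCont_tendsto_compose[of 0 q_log_series] by simp
  also have "q_log_series 0 = 0"
    using powser_zero[of "\<lambda>k. 1 / (real k * (1 - q ^ k))"] by (simp add: q_log_series_def)
  finally have "(\<lambda>N. exp (q_log_series (q ^ N * y) - q_log_series y))
      \<longlonglongrightarrow> exp (0 - q_log_series y)"
    by (intro tendsto_intros)
  then show ?thesis
    by (simp add: prod_one_minus_conv_q_log_series[OF assms])
qed

text \<open>The numerators form the product at y = q and the denominators the one at y =
  \<open>q powr x\<close>; each has a nonzero limit, so the quotient may be taken.\<close>

lemma q_Gamma_conv_q_log_series:
  assumes "0 < x"
  shows "q_Gamma q x = (1 - q) powr (1 - x) * exp (q_log_series (q powr x) - q_log_series q)"
proof -
  let ?f = "\<lambda>n. (1 - q ^ (n + 1)) / (1 - q powr (real n + x))"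
  have y: "0 \<le> q powr x" "q powr x < 1"
    using q assms by (auto simp: powr_less_one_of_base)
  have "(\<lambda>N. (\<Prod>n<N. 1 - q ^ n * q) / (\<Prod>n<N. 1 - q ^ n * q powr x))
      \<longlonglongrightarrow> exp (- q_log_series q) / exp (- q_log_series (q powr x))"
    using q y by (intro tendsto_divide prod_one_minus_tendsto) auto
  then have "(\<lambda>N. \<Prod>n<N. ?f n) \<longlonglongrightarrow> exp (q_log_series (q powr x) - q_log_series q)"
    using q by (simp add: prod_dividef powr_add powr_realpow exp_diff[symmetric] mult.commute)
  \<comment> \<open>\<open>has_prod\<close> also asks for a nonzero limit when no factor is skipped,
    which an exponential provides. Its partial products run up to and including the index.\<close>
  then have "?f has_prod exp (q_log_series (q powr x) - q_log_series q)"
    unfolding has_prod_def raw_has_prod_def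
    using LIMSEQ_lessThan_iff_atMost[of "\<lambda>A. prod ?f A"] by simp
  then show ?thesis
    unfolding q_Gamma_def by (simp add: has_prod_iff)
qed

section \<open>The power series of \<open>h\<close> and the size of its coefficients\<close>

definition h_coeff :: "real \<Rightarrow> nat \<Rightarrow> real" where
  "h_coeff \<alpha> k = 1 / (real k * (1 - q ^ k)) - \<alpha> * (1 / real k) + 1 / (real k ^ 2 * ln q)"

text \<open>The powers (1 - q)^x and (1 - q)^(1 - x) combine to the constant 1 - q. What depends on
  x splits into the q-gamma product, the factor with exponent \<alpha> and the exponential series,
  which give the three summands of \<open>h_coeff\<close> in this order.\<close>

lemma h_conv_series:
  assumes "0 < x"
  shows "(\<lambda>k. h_coeff \<alpha> k * (q powr x) ^ k) sums (h q \<alpha> x - (ln (1 - q) - q_log_series q))"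
proof -
  let ?y = "q powr x"
  have y: "0 < ?y" "?y < 1"
    using q assms by (auto simp: powr_less_one_of_base)
  then have y': "\<bar>?y\<bar> < 1" by simp
  have "\<bar>1 / (real k ^ 2 * ln q)\<bar> \<le> 1 / \<bar>ln q\<bar>" for k
  proof (cases "k = 0")
    case False
    then have "1 * \<bar>ln q\<bar> \<le> real k ^ 2 * \<bar>ln q\<bar>"
      by (intro mult_right_mono) auto
    then have "1 / (real k ^ 2 * \<bar>ln q\<bar>) \<le> 1 / (1 * \<bar>ln q\<bar>)"
      using q by (intro frac_le) auto
    then show ?thesis
      by (simp only: abs_divide abs_mult abs_one abs_power2 mult_1)
  qed simp
  then have "summable (\<lambda>k. 1 / (real k ^ 2 * ln q) * ?y ^ k)"
    using y' by (rule summable_bounded_mult_power)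
  \<comment> \<open>The term at k = 0 is 0 by division by zero, so the series from 0 equals the one
    over \<open>Suc k\<close> in \<open>h\<close>.\<close>
  then have S: "(\<lambda>k. 1 / (real k ^ 2 * ln q) * ?y ^ k) sums
      (\<Sum>k. 1 / (real (Suc k) ^ 2 * ln q) * ?y ^ Suc k)"
    using suminf_split_head summable_sums by fastforce
  have "?y ^ Suc k = q powr (real (Suc k) * x)" for k
    using q by (metis mult.commute powr_powr powr_realpow powr_gt_zero less_irrefl)
  then have S: "(\<lambda>k. 1 / (real k ^ 2 * ln q) * ?y ^ k) sums
      (\<Sum>k. q powr (real (Suc k) * x) / (real (Suc k) ^ 2 * ln q))" (is "_ sums ?S")
    using S by simp
  have L: "(\<lambda>k. 1 / (real k * (1 - q ^ k)) * ?y ^ k) sums q_log_series ?y"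
    unfolding q_log_series_def by (intro summable_sums summable_q_log_series y')
  have "h q \<alpha> x = x * ln (1 - q) + \<alpha> * ln (1 - ?y)
      + ((1 - x) * ln (1 - q) + (q_log_series ?y - q_log_series q)) + ?S"
    using q y assms by (simp add: h_def q_Gamma_conv_q_log_series[OF assms] ln_mult ln_powr)
  then have "h q \<alpha> x - (ln (1 - q) - q_log_series q)
      = q_log_series ?y - \<alpha> * (- ln (1 - ?y)) + ?S"
    by (simp add: algebra_simps)
  moreover have "(\<lambda>k. 1 / (real k * (1 - q ^ k)) * ?y ^ k - \<alpha> * (1 / real k * ?y ^ k)
      + 1 / (real k ^ 2 * ln q) * ?y ^ k) sums (q_log_series ?y - \<alpha> * (- ln (1 - ?y)) + ?S)"
    by (intro sums_add sums_diff sums_mult L S sums_ln_one_minus y')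
  ultimately show ?thesis
    by (simp add: h_coeff_def algebra_simps)
qed

text \<open>With t = - k * ln q, q^k becomes exp (- t) and 1 / (k^2 * ln q) becomes -1 / (k * t), so
  the bounds on 1 / (1 - exp (- t)) - 1 / t apply. At k = 0 every side is 0.\<close>

lemma h_coeff_bounds: "(1 / 2 - \<alpha>) / real k \<le> h_coeff \<alpha> k" "h_coeff \<alpha> k \<le> (1 - \<alpha>) / real k"
proof -
  have "(1 / 2 - \<alpha>) / real k \<le> h_coeff \<alpha> k \<and> h_coeff \<alpha> k \<le> (1 - \<alpha>) / real k"
  proof (cases "k = 0")
    case False
    define t where "t = - (real k * ln q)"
    have t: "0 < t"
      using q False by (simp add: t_def mult_pos_neg)
    have "exp (- t) = q ^ k"
      using q by (simp add: t_def exp_of_nat_mult)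
    then have "h_coeff \<alpha> k = (1 / (1 - exp (- t)) - 1 / t - \<alpha>) / real k"
      by (simp add: h_coeff_def t_def diff_divide_distrib add_divide_distrib power2_eq_square mult_ac)
    with inverse_one_minus_exp_bounds[OF t] show ?thesis
      by (simp add: divide_right_mono)
  qed (simp add: h_coeff_def)
  then show "(1 / 2 - \<alpha>) / real k \<le> h_coeff \<alpha> k" "h_coeff \<alpha> k \<le> (1 - \<alpha>) / real k"
    by auto
qed

lemma summable_h_coeff:
  assumes "\<bar>y\<bar> < 1"
  shows "summable (\<lambda>k. h_coeff \<alpha> k * y ^ k)"
proof (rule summable_bounded_mult_power[OF _ assms])
  fix k
  have "\<bar>c / real k\<bar> \<le> \<bar>c\<bar>" for c :: real
    by (cases "k = 0") (auto simp: abs_div divide_le_eq mult_le_cancel_left1)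
  from this[of "1 / 2 - \<alpha>"] this[of "1 - \<alpha>"] h_coeff_bounds[where \<alpha> = \<alpha> and k = k]
  \<comment> \<open>Both |1/2 - \<alpha>| and |1 - \<alpha>| are at most 1 + |\<alpha>|, so this
    bound, uniform in k, leaves room.\<close>
  show "\<bar>h_coeff \<alpha> k\<bar> \<le> 2 + \<bar>\<alpha>\<bar>" by linarith
qed

section \<open>The derivative of \<open>h\<close> and its complete monotonicity\<close>

lemma DERIV_h:
  assumes "0 < x"
  shows "(h q \<alpha> has_field_derivative (\<Sum>k. real k * ln q * h_coeff \<alpha> k * (q powr x) ^ k)) (at x)"
proof -
  have "((\<lambda>x. (\<Sum>k. h_coeff \<alpha> k * (q powr x) ^ k) + (ln (1 - q) - q_log_series q))
      has_field_derivative (\<Sum>k. real k * ln q * h_coeff \<alpha> k * (q powr x) ^ k)) (at x)"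
    using DERIV_add[OF has_field_derivative_powr_series[OF q assms summable_h_coeff] DERIV_const]
    by simp
  then show ?thesis
    by (rule has_field_derivative_transform_within_open[where S = "{0<..}"])
      (use assms h_conv_series in \<open>auto simp: sums_iff\<close>)
qed

text \<open>The factor s covers both cases: s = -1 for \<alpha> <= 1/2 and s = 1 for \<alpha> >= 1.
  Differentiating once brings in k * ln q <= 0, which turns the nonpositive s *
  \<open>h_coeff\<close> into nonnegative coefficients.\<close>

lemma completely_monotonic_on_scaled_deriv_h:
  assumes "\<And>k. s * h_coeff \<alpha> k \<le> 0"
  shows "completely_monotonic_on {0<..} (\<lambda>x. s * deriv (h q \<alpha>) x)"
proof (rule completely_monotonic_on_powr_series[OF q])
  let ?a = "\<lambda>k. ln q * s * (real k * h_coeff \<alpha> k)"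
  have *: "(\<lambda>k. real k * h_coeff \<alpha> k * y ^ k) sums (y * (\<Sum>k. diffs (h_coeff \<alpha>) k * y ^ k))"
    if "\<bar>y\<bar> < 1" for y
    by (intro summable_mult_index_power summable_h_coeff that)
  show S: "summable (\<lambda>k. ?a k * y ^ k)" if "\<bar>y\<bar> < 1" for y
    using summable_mult[OF sums_summable[OF *[OF that]], of "ln q * s"] by (simp add: mult_ac)
  show "0 \<le> ?a k" for k
  proof -
    have "?a k = (real k * - ln q) * - (s * h_coeff \<alpha> k)" by simp
    also have "\<dots> \<ge> 0"
      using q assms[of k] by (intro mult_nonneg_nonneg) auto
    finally show ?thesis .
  qed
  show "s * deriv (h q \<alpha>) x = (\<Sum>k. ?a k * (q powr x) ^ k)" if "0 < x" for x
  proof -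
    have y: "\<bar>q powr x\<bar> < 1"
      using q that by (simp add: powr_less_one_of_base)
    have "summable (\<lambda>k. real k * ln q * h_coeff \<alpha> k * (q powr x) ^ k)"
      using summable_mult[OF sums_summable[OF *[OF y]], of "ln q"] by (simp add: mult_ac)
    from suminf_mult[OF this, of s] show ?thesis
      unfolding DERIV_imp_deriv[OF DERIV_h[OF that]] by (simp add: mult_ac)
  qed
qed

end

text \<open>The first conjunct ensures that \<open>deriv (h q \<alpha>)\<close> is a genuine
  derivative, since \<open>deriv\<close> has some value even where no derivative exists.\<close>

theorem theorem2p2:
  fixes q \<alpha> :: real
  assumes "0 < q" and "q < 1"
  shows "(\<forall>x>0. h q \<alpha> field_differentiable at x) \<and>
    (\<alpha> \<le> 1 / 2 \<longrightarrow> completely_monotonic_on {0<..} (\<lambda>x. - deriv (h q \<alpha>) x)) \<and>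
    (\<alpha> \<ge> 1 \<longrightarrow> completely_monotonic_on {0<..} (\<lambda>x. deriv (h q \<alpha>) x))"
proof (intro conjI allI impI)
  show "h q \<alpha> field_differentiable at x" if "0 < x" for x
    using DERIV_h[OF assms that] by (auto simp: field_differentiable_def)
  note bounds = h_coeff_bounds[OF assms, where \<alpha> = \<alpha>]
  show "completely_monotonic_on {0<..} (\<lambda>x. - deriv (h q \<alpha>) x)" if "\<alpha> \<le> 1 / 2"
  proof -
    have "0 \<le> (1 / 2 - \<alpha>) / real k" for k
      using that by simp
    from order.trans[OF this bounds(1)]
    show ?thesis
      using completely_monotonic_on_scaled_deriv_h[OF assms, of "-1" \<alpha>] by simp
  qed
  show "completely_monotonic_on {0<..} (\<lambda>x. deriv (h q \<alpha>) x)" if "\<alpha> \<ge> 1"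
  proof -
    have "(1 - \<alpha>) / real k \<le> 0" for k
      using that by (simp add: divide_nonpos_nonneg)
    from order.trans[OF bounds(2) this]
    show ?thesis
      using completely_monotonic_on_scaled_deriv_h[OF assms, of 1 \<alpha>] by simp
  qed
qed

end
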